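(* Let $n\ge 1$. For all $k\in\{0,1,\dots,n\}$, all $f:\{-1,1\}^n\to[-1,1]$ and all $p\in[1,2]$, $$\big\||\nabla^k f|\big\|_{L^p}^{p}\ \ge\ C(p)^k\, W^{\ge k}(f),\qquad C(p)=\frac{2^{1-p}}{B\left(\frac12;\frac p2,\frac p2\right)},$$ where $B(x;a,b):=\int_0^x t^{a-1}(1-t)^{b-1}\,dt$ is the incomplete Beta function.
   Context: The cube $\{-1,1\}^n$ carries the uniform probability measure; $L^p$ norms and the $L^2$ inner product are with respect to it. For $f:\{-1,1\}^n\to\mathbb R$ and $i\in[n]=\{1,\dots,n\}$, $D_i f(x)=\frac{1}{2}\big(f(x^{(i\mapsto 1)})-f(x^{(i\mapsto -1)})\big)$, where $x^{(i\mapsto\pm1)}$ is $x$ with its $i$-th coordinate replaced by $\pm1$. For $J\subseteq[n]$, $D_J:=\prod_{i\in J}D_i$, with $D_\varnothing$ the identity. For $0\le k\le n$, $\nabla^k f:=(D_Jf)_{J\subseteq[n],|J|=k}$ and $|\nabla^k f|^2:=\sum_{|J|=k}|D_Jf|^2$ (pointwise). $f^{\ge k}$ is the component of $f$ orthogonal in $L^2$ to the null space of $\nabla^k$, and $W^{\ge k}(f):=\|f^{\ge k}\|_{L^2}^2$; equivalently $W^{\ge k}(f)=\sum_{|S|\ge k}\widehat f(S)^2$ with $\widehat f(S)=\mathbb E[f\chi_S]$, $\chi_S(x)=\prod_{i\in S}x_i$. *)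

theory Defs
  imports "HOL-Probability.Probability"
begin

definition cube :: "nat \<Rightarrow> (nat \<Rightarrow> real) set" where
  "cube n = {1..n} \<rightarrow>\<^sub>E {-1, 1}"

definition cube_pmf :: "nat \<Rightarrow> (nat \<Rightarrow> real) pmf" where
  "cube_pmf n = pmf_of_set (cube n)"

definition L2_inner :: "nat \<Rightarrow> ((nat \<Rightarrow> real) \<Rightarrow> real) \<Rightarrow> ((nat \<Rightarrow> real) \<Rightarrow> real) \<Rightarrow> real" where
  "L2_inner n f g = measure_pmf.expectation (cube_pmf n) (\<lambda>x. f x * g x)"

definition Lp_norm :: "nat \<Rightarrow> real \<Rightarrow> ((nat \<Rightarrow> real) \<Rightarrow> real) \<Rightarrow> real" where
  "Lp_norm n p f = measure_pmf.expectation (cube_pmf n) (\<lambda>x. \<bar>f x\<bar> powr p) powr (1 / p)"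

definition deriv1 :: "nat \<Rightarrow> ((nat \<Rightarrow> real) \<Rightarrow> real) \<Rightarrow> ((nat \<Rightarrow> real) \<Rightarrow> real)" where
  "deriv1 i f = (\<lambda>x. (f (x(i := 1)) - f (x(i := -1))) / 2)"

(* The operators deriv1 i commute (comp_fun_commute_deriv1), so for finite J the fold is their
   composition in any order. *)
definition derivs :: "nat set \<Rightarrow> ((nat \<Rightarrow> real) \<Rightarrow> real) \<Rightarrow> ((nat \<Rightarrow> real) \<Rightarrow> real)" where
  "derivs J f = Finite_Set.fold deriv1 f J"

definition grad_norm :: "nat \<Rightarrow> nat \<Rightarrow> ((nat \<Rightarrow> real) \<Rightarrow> real) \<Rightarrow> ((nat \<Rightarrow> real) \<Rightarrow> real)" where
  "grad_norm n k f = (\<lambda>x. sqrt (\<Sum>J | J \<subseteq> {1..n} \<and> card J = k. \<bar>derivs J f x\<bar>\<^sup>2))"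

definition grad_null :: "nat \<Rightarrow> nat \<Rightarrow> ((nat \<Rightarrow> real) \<Rightarrow> real) set" where
  "grad_null n k = {g. \<forall>J. J \<subseteq> {1..n} \<and> card J = k \<longrightarrow> (\<forall>x\<in>cube n. derivs J g x = 0)}"

(* Functions on the cube are represented by functions on all of nat => real of which only the
   values on the cube matter; extensionality makes the orthogonal component unique
   (high_part_ex1). *)
definition high_part :: "nat \<Rightarrow> nat \<Rightarrow> ((nat \<Rightarrow> real) \<Rightarrow> real) \<Rightarrow> ((nat \<Rightarrow> real) \<Rightarrow> real)" where
  "high_part n k f = (THE g. g \<in> extensional (cube n) \<and>
     (\<lambda>x. f x - g x) \<in> grad_null n k \<and> (\<forall>h\<in>grad_null n k. L2_inner n g h = 0))"

definition high_weight :: "nat \<Rightarrow> nat \<Rightarrow> ((nat \<Rightarrow> real) \<Rightarrow> real) \<Rightarrow> real" where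
  "high_weight n k f = (Lp_norm n 2 (high_part n k f))\<^sup>2"

definition incomplete_Beta :: "real \<Rightarrow> real \<Rightarrow> real \<Rightarrow> real" where
  "incomplete_Beta x a b = integral {0..x} (\<lambda>t. t powr (a - 1) * (1 - t) powr (b - 1))"

definition C_const :: "real \<Rightarrow> real" where
  "C_const p = 2 powr (1 - p) / incomplete_Beta (1/2) (p/2) (p/2)"

lemma comp_fun_commute_deriv1: "comp_fun_commute deriv1"
proof
  fix i j :: nat
  show "deriv1 j \<circ> deriv1 i = deriv1 i \<circ> deriv1 j"
    by (cases "i = j") (auto simp: deriv1_def fun_eq_iff fun_upd_twist field_simps)
qed

lemma derivs_empty [simp]: "derivs {} f = f"
  by (simp add: derivs_def)

lemma derivs_insert:
  assumes "finite J" "i \<notin> J"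
  shows "derivs (insert i J) f = deriv1 i (derivs J f)"
proof -
  interpret comp_fun_commute deriv1 by (fact comp_fun_commute_deriv1)
  show ?thesis using assms by (simp add: derivs_def)
qed

lemma finite_cube: "finite (cube n)"
  by (auto simp: cube_def intro: finite_PiE)

lemma cube_nonempty: "cube n \<noteq> {}"
  by (auto simp: cube_def PiE_eq_empty_iff)

lemma card_cube: "card (cube n) = 2 ^ n"
  by (simp add: cube_def card_PiE numeral_2_eq_2)

lemma cube_expectation:
  "measure_pmf.expectation (cube_pmf n) f = (\<Sum>x\<in>cube n. f x) / 2 ^ n" for f :: "_ \<Rightarrow> real"
  using integral_pmf_of_set[OF cube_nonempty finite_cube, where f = f]
  by (simp add: cube_pmf_def card_cube)

lemma cube_upd: "x \<in> cube n \<Longrightarrow> i \<in> {1..n} \<Longrightarrow> b \<in> {-1, 1} \<Longrightarrow> x(i := b) \<in> cube n"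
  unfolding cube_def by (auto simp: PiE_iff extensional_def)

lemma derivs_cong:
  assumes "finite J" "J \<subseteq> {1..n}" "\<And>x. x \<in> cube n \<Longrightarrow> f x = g x" "x \<in> cube n"
  shows "derivs J f x = derivs J g x"
  using assms(1,2,4)
proof (induction J arbitrary: x rule: finite_induct)
  case (insert i J)
  then show ?case by (simp add: derivs_insert deriv1_def cube_upd)
qed (simp add: assms(3))

lemma derivs_lin:
  assumes "finite J"
  shows "derivs J (\<lambda>x. \<Sum>s\<in>A. c s * f s x) = (\<lambda>x. \<Sum>s\<in>A. c s * derivs J (f s) x)"
  using assms
proof (induction J rule: finite_induct)
  case (insert i J)
  show ?case
    by (simp add: derivs_insert insert.hyps insert.IH deriv1_def right_diff_distrib
        sum_subtractf diff_divide_distrib sum_divide_distrib)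
qed simp

lemma derivs_diff:
  assumes "finite J"
  shows "derivs J (\<lambda>x. f x - g x) = (\<lambda>x. derivs J f x - derivs J g x)"
  using assms
proof (induction J rule: finite_induct)
  case (insert i J)
  show ?case
    unfolding derivs_insert[OF insert.hyps] insert.IH by (simp add: deriv1_def fun_eq_iff field_simps)
qed simp

definition walsh :: "nat set \<Rightarrow> (nat \<Rightarrow> real) \<Rightarrow> real" where
  "walsh S x = (\<Prod>i\<in>S. x i)"

lemma derivs_walsh:
  assumes "finite J" "finite S"
  shows "derivs J (walsh S) = (\<lambda>x. if J \<subseteq> S then walsh (S - J) x else 0)"
  using assms(1)
proof (induction J rule: finite_induct)
  case (insert i J)
  have upd: "walsh T (x(i := b)) = (if i \<in> T then b * walsh (T - {i}) x else walsh T x)"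
    if "finite T" for T x b
  proof (cases "i \<in> T")
    case True
    have "walsh T (x(i := b)) = b * walsh (T - {i}) (x(i := b))"
      using prod.remove[OF that True, of "x(i := b)"] by (simp add: walsh_def)
    moreover have "walsh (T - {i}) (x(i := b)) = walsh (T - {i}) x"
      unfolding walsh_def by (rule prod.cong) auto
    ultimately show ?thesis using True by simp
  next
    case False
    then show ?thesis unfolding walsh_def by (auto intro!: prod.cong)
  qed
  have *: "S - insert i J = S - J - {i}" by auto
  show ?case
    using insert assms(2) unfolding *
    by (auto simp: derivs_insert deriv1_def fun_eq_iff upd)
qed auto

lemma sum_cube_flip:
  assumes i: "i \<in> {1..n}"
  shows "(\<Sum>x\<in>cube n. g (x(i := - x i))) = (\<Sum>x\<in>cube n. g x)"
proof (rule sum.reindex_bij_witness[of _ "\<lambda>x. x(i := - x i)" "\<lambda>x. x(i := - x i)"])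
  fix x assume x: "x \<in> cube n"
  then have "x i \<in> {-1, 1}" using i unfolding cube_def by blast
  then show "x(i := - x i) \<in> cube n" by (intro cube_upd x i) auto
  then show "x(i := - x i) \<in> cube n" .
qed auto

lemma L2_inner_deriv1:
  assumes i: "i \<in> {1..n}" and T: "finite T" "i \<notin> T"
  shows "L2_inner n (deriv1 i f) (walsh T) = L2_inner n f (walsh (insert i T))"
proof -
  let ?F = "\<lambda>x. f x * walsh (insert i T) x"
  have "deriv1 i f x * walsh T x = (?F x + ?F (x(i := - x i))) / 2" if x: "x \<in> cube n" for x
  proof -
    have xi: "x i = 1 \<or> x i = -1" using x i unfolding cube_def by blast
    have w: "walsh T (x(i := b)) = walsh T x" for b
      unfolding walsh_def using T by (intro prod.cong) auto
    have w': "walsh (insert i T) y = y i * walsh T y" for y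
      using T by (simp add: walsh_def)
    have "x = x(i := x i)" by simp
    then show ?thesis using xi
      by (elim disjE) (auto simp: deriv1_def w w' field_simps)
  qed
  then have "(\<Sum>x\<in>cube n. deriv1 i f x * walsh T x)
      = ((\<Sum>x\<in>cube n. ?F x) + (\<Sum>x\<in>cube n. ?F (x(i := - x i)))) / 2"
    by (simp add: sum.distrib sum_divide_distrib add_divide_distrib)
  also have "\<dots> = (\<Sum>x\<in>cube n. ?F x)"
    using sum_cube_flip[OF i, of ?F] by simp
  finally show ?thesis by (simp add: L2_inner_def cube_expectation)
qed

lemma L2_inner_derivs:
  assumes "finite J" "J \<subseteq> {1..n}" "finite T" "J \<inter> T = {}"
  shows "L2_inner n (derivs J f) (walsh T) = L2_inner n f (walsh (J \<union> T))"
  using assms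
proof (induction J arbitrary: T rule: finite_induct)
  case (insert i J)
  have "L2_inner n (derivs (insert i J) f) (walsh T) = L2_inner n (derivs J f) (walsh (insert i T))"
    using insert by (simp add: derivs_insert L2_inner_deriv1)
  also have "\<dots> = L2_inner n f (walsh (J \<union> insert i T))"
    using insert by (intro insert.IH) auto
  finally show ?case by simp
qed simp

lemma walsh_expansion:
  assumes "x \<in> cube n"
  shows "f x = (\<Sum>S\<in>Pow {1..n}. L2_inner n f (walsh S) * walsh S x)"
proof -
  have K: "(\<Sum>S\<in>Pow {1..n}. walsh S y * walsh S x) = (if y = x then 2 ^ n else 0)"
    if y: "y \<in> cube n" for y
  proof -
    have "(\<Sum>S\<in>Pow {1..n}. walsh S y * walsh S x) = (\<Prod>i\<in>{1..n}. y i * x i + 1)"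
      by (simp add: prod_add walsh_def prod.distrib)
    also have "\<dots> = (if y = x then 2 ^ n else 0)"
    proof (cases "y = x")
      case True
      have "y i * x i + 1 = 2" if "i \<in> {1..n}" for i
      proof -
        have "x i \<in> {-1, 1}" using assms that unfolding cube_def by blast
        then show ?thesis using True by auto
      qed
      then have "(\<Prod>i\<in>{1..n}. y i * x i + 1) = (\<Prod>i\<in>{1..n}. 2)" by (intro prod.cong) auto
      then show ?thesis using True by simp
    next
      case False
      then obtain i where i: "i \<in> {1..n}" "y i \<noteq> x i"
        using PiE_ext[OF y[unfolded cube_def] assms[unfolded cube_def]] by blast
      have "x i \<in> {-1, 1}" "y i \<in> {-1, 1}"
        using assms y i(1) unfolding cube_def by blast+
      then have "y i * x i + 1 = 0" using i(2) by auto
      then have "(\<Prod>i\<in>{1..n}. y i * x i + 1) = 0" using i(1) by (intro prod_zero) auto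
      then show ?thesis using False by simp
    qed
    finally show ?thesis .
  qed
  have "(\<Sum>S\<in>Pow {1..n}. L2_inner n f (walsh S) * walsh S x)
      = (\<Sum>S\<in>Pow {1..n}. \<Sum>y\<in>cube n. f y * (walsh S y * walsh S x) / 2 ^ n)"
    by (simp add: L2_inner_def cube_expectation sum_distrib_right sum_divide_distrib mult.assoc)
  also have "\<dots> = (\<Sum>y\<in>cube n. \<Sum>S\<in>Pow {1..n}. f y * (walsh S y * walsh S x) / 2 ^ n)"
    by (rule sum.swap)
  also have "\<dots> = (\<Sum>y\<in>cube n. f y * (\<Sum>S\<in>Pow {1..n}. walsh S y * walsh S x) / 2 ^ n)"
    by (simp add: sum_distrib_left sum_divide_distrib)
  also have "\<dots> = (\<Sum>y\<in>cube n. if y = x then f y else 0)"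
    by (intro sum.cong refl) (subst K, simp_all)
  also have "\<dots> = f x" using assms finite_cube by simp
  finally show ?thesis by simp
qed

lemma high_part_ex1:
  "\<exists>!g. g \<in> extensional (cube n) \<and> (\<lambda>x. f x - g x) \<in> grad_null n k \<and>
     (\<forall>h\<in>grad_null n k. L2_inner n g h = 0)"
proof (rule ex_ex1I)
  define a where "a S = L2_inner n f (walsh S)" for S
  define Hi where "Hi = {S \<in> Pow {1..n}. k \<le> card S}"
  define Lo where "Lo = {S \<in> Pow {1..n}. card S < k}"
  define g where "g = restrict (\<lambda>x. \<Sum>S\<in>Hi. a S * walsh S x) (cube n)"
  have fg: "f x - g x = (\<Sum>S\<in>Lo. a S * walsh S x)" if "x \<in> cube n" for x
  proof -
    have "Pow {1..n} = Hi \<union> Lo" "Hi \<inter> Lo = {}" "finite Hi" "finite Lo"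
      by (auto simp: Hi_def Lo_def)
    then show ?thesis
      using walsh_expansion[OF that, of f] that by (simp add: g_def a_def sum.union_disjoint)
  qed
  have "(\<lambda>x. f x - g x) \<in> grad_null n k"
    unfolding grad_null_def
  proof (intro CollectI allI impI ballI)
    fix J x assume J: "J \<subseteq> {1..n} \<and> card J = k" and x: "x \<in> cube n"
    have fin: "finite J" using J finite_subset by blast
    have "derivs J (\<lambda>x. f x - g x) x = derivs J (\<lambda>x. \<Sum>S\<in>Lo. a S * walsh S x) x"
      using fin J x fg by (intro derivs_cong[of J n]) auto
    also have "\<dots> = (\<Sum>S\<in>Lo. a S * derivs J (walsh S) x)"
      using derivs_lin[OF fin, where A = Lo and c = a and f = walsh] by simp
    also have "\<dots> = 0"
    proof (intro sum.neutral ballI)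
      fix S assume "S \<in> Lo"
      then have S: "finite S" "card S < card J" using J by (auto simp: Lo_def intro: finite_subset)
      then have "\<not> J \<subseteq> S" using card_mono leD by blast
      then show "a S * derivs J (walsh S) x = 0" using fin S by (simp add: derivs_walsh)
    qed
    finally show "derivs J (\<lambda>x. f x - g x) x = 0" .
  qed
  moreover have "L2_inner n g h = 0" if h: "h \<in> grad_null n k" for h
  proof -
    have z: "L2_inner n h (walsh S) = 0" if S: "S \<in> Hi" for S
    proof -
      have Sn: "S \<subseteq> {1..n}" "k \<le> card S" using S by (auto simp: Hi_def)
      obtain J where J: "J \<subseteq> S" "card J = k" "finite J"
        using obtain_subset_with_card_n[OF Sn(2)] by blast
      have "finite S" using Sn(1) finite_subset by blast
      then have "L2_inner n (derivs J h) (walsh (S - J)) = L2_inner n h (walsh (J \<union> (S - J)))"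
        using J Sn by (intro L2_inner_derivs) auto
      moreover have "J \<union> (S - J) = S" using J by auto
      moreover have "L2_inner n (derivs J h) (walsh (S - J)) = 0"
        using h J Sn by (auto simp: L2_inner_def cube_expectation grad_null_def)
      ultimately show ?thesis by simp
    qed
    have "L2_inner n g h = (\<Sum>x\<in>cube n. \<Sum>S\<in>Hi. a S * (h x * walsh S x)) / 2 ^ n"
      by (simp add: L2_inner_def cube_expectation g_def sum_distrib_left sum_distrib_right mult_ac)
    also have "\<dots> = (\<Sum>S\<in>Hi. a S * L2_inner n h (walsh S))"
      by (subst sum.swap) (simp add: L2_inner_def cube_expectation sum_distrib_left sum_divide_distrib)
    finally show ?thesis using z by simp
  qed
  ultimately show "\<exists>g. g \<in> extensional (cube n) \<and> (\<lambda>x. f x - g x) \<in> grad_null n k \<and>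
     (\<forall>h\<in>grad_null n k. L2_inner n g h = 0)"
    by (intro exI[of _ g]) (auto simp: g_def)
next
  fix g g'
  assume g: "g \<in> extensional (cube n) \<and> (\<lambda>x. f x - g x) \<in> grad_null n k \<and>
      (\<forall>h\<in>grad_null n k. L2_inner n g h = 0)"
    and g': "g' \<in> extensional (cube n) \<and> (\<lambda>x. f x - g' x) \<in> grad_null n k \<and>
      (\<forall>h\<in>grad_null n k. L2_inner n g' h = 0)"
  define d where "d x = g x - g' x" for x
  have d: "d = (\<lambda>x. (f x - g' x) - (f x - g x))" by (simp add: d_def fun_eq_iff)
  have "derivs J d x = 0" if J: "J \<subseteq> {1..n}" "card J = k" and x: "x \<in> cube n" for J x
  proof -
    have "finite J" using J(1) finite_subset by blast
    then have "derivs J d x = derivs J (\<lambda>x. f x - g' x) x - derivs J (\<lambda>x. f x - g x) x"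
      unfolding d by (subst derivs_diff) simp_all
    then show ?thesis using g g' J x unfolding grad_null_def by simp
  qed
  then have "d \<in> grad_null n k" by (simp add: grad_null_def)
  then have "L2_inner n g d - L2_inner n g' d = 0" using g g' by simp
  moreover have "L2_inner n g d - L2_inner n g' d = (\<Sum>x\<in>cube n. (d x)\<^sup>2) / 2 ^ n"
  proof -
    have "(d x)\<^sup>2 = g x * d x - g' x * d x" for x
      by (simp add: d_def power2_eq_square algebra_simps)
    then show ?thesis
      by (simp add: L2_inner_def cube_expectation sum_subtractf diff_divide_distrib)
  qed
  ultimately have "\<forall>x\<in>cube n. d x = 0"
    using finite_cube by (simp add: sum_nonneg_eq_0_iff)
  then show "g = g'"
    using g g' by (intro extensionalityI[of _ "cube n"]) (auto simp: d_def)
qed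

end

theory Submission
  imports Defs
begin

text \<open>
  Write \<open>a S\<close> for the Walsh coefficients of \<open>f\<close> and \<open>P \<rho>\<close> for the noise operator, which
  multiplies the coefficient of \<open>S\<close> by \<open>\<rho> ^ card S\<close>. The proof compares the \<open>k\<close>-th
  derivative of \<open>\<rho> \<mapsto> E (f * P \<rho> f)\<close>, which equals \<open>k!\<close> times
  \<open>E (\<Sum>J. D J f * P \<rho> (D J f))\<close>, where \<open>J\<close> ranges over the sets of size \<open>k\<close>, with the
  \<open>L\<^sup>p\<close> norm of the gradient.

  The bound on \<open>f\<close> enters through a pointwise estimate. Integration by parts against the
  noise kernel writes \<open>P \<rho> (D J f) x\<close> as the average of \<open>f\<close> times a score function, a
  product over \<open>J\<close> of centred coordinates divided by their variance \<open>1 - \<rho>\<^sup>2\<close>. The scores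
  for different \<open>J\<close> are orthogonal under the kernel, with squared norm
  \<open>(1 - \<rho>\<^sup>2) powr (- k)\<close>, so Bessel's inequality and \<open>\<bar>f\<bar> \<le> 1\<close> give
  \<open>\<bar>P \<rho> (\<nabla>\<^sup>k f)\<bar> \<le> (1 - \<rho>\<^sup>2) powr (- k / 2)\<close> (\<open>noise_grad_bound\<close>). Spending the power \<open>2 - p\<close> of
  \<open>\<bar>P \<rho> (\<nabla>\<^sup>k f)\<bar>\<close> on this bound, and the remaining \<open>p - 1\<close> on Young's inequality and the
  contractivity of \<open>P \<rho>\<close> on \<open>L\<^sup>p\<close>, yields, with \<open>A\<close> the \<open>p\<close>-th power of the \<open>L\<^sup>p\<close> norm,
  \<open>(\<Sum>S. (card S choose k) * \<rho> ^ (card S - k) * (a S)\<^sup>2) \<le> A * h ^ k\<close>, where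
  \<open>h = (1 - \<rho>\<^sup>2) powr (p / 2 - 1)\<close> (\<open>noise_energy_bound\<close>).

  It remains to integrate over \<open>\<theta> = 1 - \<rho>\<close>. With weight \<open>k * \<theta> ^ (k - 1)\<close> the left-hand side
  integrates over \<open>[0, 1]\<close> to the high-degree weight, since \<open>k * (m choose k) * \<theta> ^ (k - 1) *
  (1 - \<theta>) ^ (m - k)\<close> is the density of the \<open>k\<close>-th smallest of \<open>m\<close> uniform variables. On the
  right, let \<open>H\<close> be the primitive of \<open>h\<close> vanishing at \<open>\<theta> = 0\<close>. As \<open>h\<close> decreases in \<open>\<theta>\<close>,
  \<open>\<theta> * h \<le> H\<close>, so \<open>k * \<theta> ^ (k - 1) * h ^ k \<le> k * H ^ (k - 1) * h\<close>, which is the derivative of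
  \<open>H ^ k\<close>. The total is at most \<open>A * H 1 ^ k\<close> (\<open>sum_le_of_binomial_bound\<close>), and \<open>H 1\<close> is an
  incomplete Beta integral equal to \<open>1 / C_const p\<close>. This needs \<open>k > 0\<close>; for \<open>k = 0\<close> the
  claim is \<open>f\<^sup>2 \<le> \<bar>f\<bar> powr p\<close> for \<open>\<bar>f\<bar> \<le> 1\<close>.
\<close>

section \<open>Walsh coefficients and the high-degree weight\<close>

lemma cube_coord:
  assumes "x \<in> cube n" "i \<in> {1..n}"
  shows "x i = 1 \<or> x i = -1"
proof -
  have "x i \<in> {-1, 1}" using assms unfolding cube_def by blast
  then show ?thesis by auto
qed

text \<open>Averages of products over the cube factor into one-coordinate sums; all kernel
  computations below reduce to this.\<close>
lemma sum_cube_prod: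
  fixes g :: "nat \<Rightarrow> real \<Rightarrow> real"
  shows "(\<Sum>y\<in>cube n. \<Prod>i\<in>{1..n}. g i (y i)) = (\<Prod>i\<in>{1..n}. g i (-1) + g i 1)"
  using prod_sum_PiE[of "{1..n}" "\<lambda>_. {-1, 1}" g] by (simp add: cube_def)

lemma derivs_walsh_expansion:
  assumes "J \<subseteq> {1..n}" "x \<in> cube n"
  shows "derivs J f x
    = (\<Sum>S\<in>Pow {1..n}. L2_inner n f (walsh S) * (if J \<subseteq> S then walsh (S - J) x else 0))"
proof -
  have fin: "finite J" using assms(1) finite_subset by blast
  have "derivs J f x = derivs J (\<lambda>x. \<Sum>S\<in>Pow {1..n}. L2_inner n f (walsh S) * walsh S x) x"
    using fin assms walsh_expansion by (intro derivs_cong) auto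
  also have "\<dots> = (\<Sum>S\<in>Pow {1..n}. L2_inner n f (walsh S) * derivs J (walsh S) x)"
    using derivs_lin[OF fin, where A = "Pow {1..n}" and c = "\<lambda>S. L2_inner n f (walsh S)" and f = walsh]
    by simp
  also have "\<dots> = (\<Sum>S\<in>Pow {1..n}. L2_inner n f (walsh S) * (if J \<subseteq> S then walsh (S - J) x else 0))"
    using fin by (intro sum.cong refl) (auto simp: derivs_walsh finite_subset)
  finally show ?thesis .
qed

lemma parseval:
  "L2_inner n g g = (\<Sum>S\<in>Pow {1..n}. (L2_inner n g (walsh S))\<^sup>2)"
proof -
  have "L2_inner n g g
      = (\<Sum>x\<in>cube n. g x * (\<Sum>S\<in>Pow {1..n}. L2_inner n g (walsh S) * walsh S x)) / 2 ^ n"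
    unfolding L2_inner_def[of n g g] cube_expectation
    using walsh_expansion[of _ n g] by (intro arg_cong2[where f = "(/)"] sum.cong refl) simp_all
  also have "\<dots> = (\<Sum>x\<in>cube n. \<Sum>S\<in>Pow {1..n}. L2_inner n g (walsh S) * (g x * walsh S x)) / 2 ^ n"
    by (simp add: sum_distrib_left mult_ac)
  also have "\<dots> = (\<Sum>S\<in>Pow {1..n}. L2_inner n g (walsh S) * L2_inner n g (walsh S))"
    by (subst sum.swap) (simp add: L2_inner_def cube_expectation sum_distrib_left sum_divide_distrib)
  finally show ?thesis by (simp add: power2_eq_square)
qed

lemma walsh_coeff_grad_null:
  assumes "h \<in> grad_null n k" "S \<subseteq> {1..n}" "k \<le> card S"
  shows "L2_inner n h (walsh S) = 0"
proof -
  obtain J where J: "J \<subseteq> S" "card J = k" "finite J"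
    using obtain_subset_with_card_n[OF assms(3)] by blast
  have "finite S" using assms(2) finite_subset by blast
  then have "L2_inner n (derivs J h) (walsh (S - J)) = L2_inner n h (walsh (J \<union> (S - J)))"
    using J assms(2) by (intro L2_inner_derivs) auto
  moreover have "J \<union> (S - J) = S" using J by auto
  moreover have "L2_inner n (derivs J h) (walsh (S - J)) = 0"
    using assms J by (auto simp: L2_inner_def cube_expectation grad_null_def)
  ultimately show ?thesis by simp
qed

lemma walsh_in_grad_null:
  assumes "S \<subseteq> {1..n}" "card S < k"
  shows "walsh S \<in> grad_null n k"
  unfolding grad_null_def
proof (intro CollectI allI impI ballI)
  fix J x assume J: "J \<subseteq> {1..n} \<and> card J = k" and "x \<in> cube n"
  have fin: "finite J" "finite S" using J assms(1) finite_subset by blast+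
  have "\<not> J \<subseteq> S" using card_mono[OF fin(2), of J] J assms(2) by auto
  then show "derivs J (walsh S) x = 0" using fin by (simp add: derivs_walsh)
qed

text \<open>The null space of the \<open>k\<close>-th gradient is the span of the Walsh functions of degree below
  \<open>k\<close>, so projecting it away keeps exactly the coefficients of degree at least \<open>k\<close>.\<close>
lemma high_weight_eq:
  "high_weight n k f = (\<Sum>S | S \<subseteq> {1..n} \<and> k \<le> card S. (L2_inner n f (walsh S))\<^sup>2)"
proof -
  define g where "g = high_part n k f"
  have g: "(\<lambda>x. f x - g x) \<in> grad_null n k" "\<And>h. h \<in> grad_null n k \<Longrightarrow> L2_inner n g h = 0"
    using theI'[OF high_part_ex1[of n f k]] unfolding g_def high_part_def by auto
  have hi: "L2_inner n g (walsh S) = L2_inner n f (walsh S)" if "S \<subseteq> {1..n}" "k \<le> card S" for S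
    using walsh_coeff_grad_null[OF g(1) that]
    by (simp add: L2_inner_def cube_expectation left_diff_distrib sum_subtractf diff_divide_distrib)
  have lo: "L2_inner n g (walsh S) = 0" if "S \<subseteq> {1..n}" "\<not> k \<le> card S" for S
    using g(2)[OF walsh_in_grad_null] that by simp
  have "high_weight n k f = L2_inner n g g"
  proof -
    have "0 \<le> (\<Sum>x\<in>cube n. (g x)\<^sup>2) / 2 ^ n" by (intro divide_nonneg_nonneg sum_nonneg) auto
    then show ?thesis
      unfolding high_weight_def g_def[symmetric] Lp_norm_def L2_inner_def cube_expectation
      by (simp add: powr_half_sqrt flip: power2_eq_square)
  qed
  also have "\<dots> = (\<Sum>S\<in>Pow {1..n}. (L2_inner n g (walsh S))\<^sup>2)" by (rule parseval)
  also have "\<dots> = (\<Sum>S | S \<subseteq> {1..n} \<and> k \<le> card S. (L2_inner n f (walsh S))\<^sup>2)"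
    using hi lo by (intro sum.mono_neutral_cong_right) auto
  finally show ?thesis .
qed

section \<open>The noise kernel and its score functions\<close>

text \<open>The probability, for \<open>y\<close> in the cube, that \<open>y\<close> is the \<open>\<rho>\<close>-correlated copy of \<open>x\<close>:
  independently for each \<open>i\<close>, \<open>y i = x i\<close> with probability \<open>(1 + \<rho>) / 2\<close>.\<close>
definition noise_kernel :: "nat \<Rightarrow> real \<Rightarrow> (nat \<Rightarrow> real) \<Rightarrow> (nat \<Rightarrow> real) \<Rightarrow> real" where
  "noise_kernel n \<rho> x y = (\<Prod>i\<in>{1..n}. (1 + \<rho> * x i * y i) / 2)"

definition noise :: "nat \<Rightarrow> real \<Rightarrow> ((nat \<Rightarrow> real) \<Rightarrow> real) \<Rightarrow> (nat \<Rightarrow> real) \<Rightarrow> real" where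
  "noise n \<rho> g x = (\<Sum>y\<in>cube n. noise_kernel n \<rho> x y * g y)"

text \<open>Given \<open>x\<close>, the coordinate \<open>y i\<close> has mean \<open>\<rho> * x i\<close> and variance \<open>1 - \<rho>\<^sup>2\<close>. The
  normalisation by the variance, not its root, makes averaging against \<open>score \<rho> x J\<close>
  reproduce the smoothed derivative in the directions \<open>J\<close>.\<close>
definition score :: "real \<Rightarrow> (nat \<Rightarrow> real) \<Rightarrow> nat set \<Rightarrow> (nat \<Rightarrow> real) \<Rightarrow> real" where
  "score \<rho> x J y = (\<Prod>i\<in>J. (y i - \<rho> * x i) / (1 - \<rho>\<^sup>2))"

lemma noise_kernel_sym: "noise_kernel n \<rho> x y = noise_kernel n \<rho> y x"
  by (simp add: noise_kernel_def mult_ac)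

lemma noise_kernel_nonneg:
  assumes "x \<in> cube n" "y \<in> cube n" "\<bar>\<rho>\<bar> \<le> 1"
  shows "0 \<le> noise_kernel n \<rho> x y"
  unfolding noise_kernel_def
proof (intro prod_nonneg)
  fix i assume i: "i \<in> {1..n}"
  show "0 \<le> (1 + \<rho> * x i * y i) / 2"
    using cube_coord[OF assms(1) i] cube_coord[OF assms(2) i] assms(3) by auto
qed

lemma prod_subset_if:
  fixes g :: "nat \<Rightarrow> real"
  assumes "J \<subseteq> {1..n}"
  shows "(\<Prod>i\<in>J. g i) = (\<Prod>i\<in>{1..n}. if i \<in> J then g i else 1)"
  using assms prod.inter_restrict[of "{1..n}" g J] by (simp add: Int_absorb1)

text \<open>With \<open>t\<close> standing for \<open>\<rho> * x i\<close> and \<open>D\<close> for the variance, these are the mean of the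
  one-coordinate score, its correlation with \<open>y i\<close>, and its second moment.\<close>
lemma score_moments:
  fixes t D :: real
  assumes "D = 1 - t * t" "D \<noteq> 0"
  shows "(1 + t * (-1)) / 2 * ((-1 - t) / D) + (1 + t * 1) / 2 * ((1 - t) / D) = 0"
    and "(1 + t * (-1)) / 2 * ((-1 - t) / D) * (-1) + (1 + t * 1) / 2 * ((1 - t) / D) * 1 = 1"
    and "(1 + t * (-1)) / 2 * ((-1 - t) / D) * ((-1 - t) / D)
      + (1 + t * 1) / 2 * ((1 - t) / D) * ((1 - t) / D) = 1 / D"
proof -
  show "(1 + t * (-1)) / 2 * ((-1 - t) / D) + (1 + t * 1) / 2 * ((1 - t) / D) = 0"
    using assms(2) by (simp add: field_simps)
  show "(1 + t * (-1)) / 2 * ((-1 - t) / D) * (-1) + (1 + t * 1) / 2 * ((1 - t) / D) * 1 = 1"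
  proof -
    have "(1 + t * (-1)) / 2 * ((-1 - t) / D) * (-1) + (1 + t * 1) / 2 * ((1 - t) / D) * 1
        = (2 * (1 - t * t)) / (2 * D)"
      using assms(2) by (simp add: add_divide_distrib[symmetric] algebra_simps)
    then show ?thesis using assms by simp
  qed
  have "(1 + t * (-1)) / 2 * ((-1 - t) / D) * ((-1 - t) / D)
      + (1 + t * 1) / 2 * ((1 - t) / D) * ((1 - t) / D)
      = ((1 - t) * (1 + t)\<^sup>2 + (1 + t) * (1 - t)\<^sup>2) / (2 * D * D)"
    using assms(2) by (simp add: field_simps power2_eq_square)
  also have "(1 - t) * (1 + t)\<^sup>2 + (1 + t) * (1 - t)\<^sup>2 = 2 * D"
    unfolding assms(1) by algebra
  finally show "(1 + t * (-1)) / 2 * ((-1 - t) / D) * ((-1 - t) / D)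
      + (1 + t * 1) / 2 * ((1 - t) / D) * ((1 - t) / D) = 1 / D"
    using assms(2) by simp
qed

text \<open>Coordinatewise, the kernel average of \<open>y i\<close> is \<open>\<rho> * x i\<close>, the score has mean zero, and
  score times \<open>y i\<close> has mean one. Hence a coordinate of \<open>J\<close> outside \<open>S\<close> kills the average,
  one inside \<open>S\<close> removes \<open>i\<close> from the Walsh function, and the others contribute a
  factor \<open>\<rho>\<close>. Taking \<open>J\<close> empty gives the action of the noise operator on Walsh functions.\<close>
lemma noise_score_walsh:
  assumes "J \<subseteq> {1..n}" "S \<subseteq> {1..n}" "x \<in> cube n" "\<bar>\<rho>\<bar> < 1"
  shows "noise n \<rho> (\<lambda>y. score \<rho> x J y * walsh S y) x
    = (if J \<subseteq> S then \<rho> ^ card (S - J) * walsh (S - J) x else 0)"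
proof -
  have r: "1 - \<rho>\<^sup>2 \<noteq> 0" using assms(4) by (simp add: abs_square_eq_1 abs_if split: if_splits)
  let ?g = "\<lambda>i b. (1 + \<rho> * x i * b) / 2 * (if i \<in> J then (b - \<rho> * x i) / (1 - \<rho>\<^sup>2) else 1)
      * (if i \<in> S then b else 1)"
  let ?h = "\<lambda>i. if i \<in> J then (if i \<in> S then 1 else 0) else if i \<in> S then \<rho> * x i else 1"
  have "noise n \<rho> (\<lambda>y. score \<rho> x J y * walsh S y) x = (\<Sum>y\<in>cube n. \<Prod>i\<in>{1..n}. ?g i (y i))"
    unfolding noise_def noise_kernel_def score_def walsh_def
    by (simp only: prod_subset_if[OF assms(1)] prod_subset_if[OF assms(2)] prod.distrib mult.assoc)
  also have "\<dots> = (\<Prod>i\<in>{1..n}. ?g i (-1) + ?g i 1)" by (rule sum_cube_prod)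
  also have "\<dots> = (\<Prod>i\<in>{1..n}. ?h i)"
  proof (intro prod.cong refl)
    fix i assume i: "i \<in> {1..n}"
    have D: "1 - \<rho>\<^sup>2 = 1 - (\<rho> * x i) * (\<rho> * x i)"
      using cube_coord[OF assms(3) i] by (auto simp: power2_eq_square)
    note m = score_moments[OF D r]
    consider "i \<in> J" "i \<in> S" | "i \<in> J" "i \<notin> S" | "i \<notin> J" "i \<in> S" | "i \<notin> J" "i \<notin> S"
      by blast
    then show "?g i (-1) + ?g i 1 = ?h i"
    proof cases
      case 1
      then show ?thesis using m(2) by (simp only: if_True)
    next
      case 2
      then show ?thesis using m(1) by (simp only: if_True if_False mult_1_right)
    next
      case 3
      then show ?thesis by (simp add: field_simps)
    next
      case 4
      then show ?thesis by (simp add: field_simps)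
    qed
  qed
  also have "\<dots> = (if J \<subseteq> S then \<rho> ^ card (S - J) * walsh (S - J) x else 0)"
  proof (cases "J \<subseteq> S")
    case True
    have "(\<Prod>i\<in>{1..n}. ?h i) = (\<Prod>i\<in>{1..n}. if i \<in> S - J then \<rho> * x i else 1)"
      using True by (intro prod.cong) auto
    also have "\<dots> = (\<Prod>i\<in>S - J. \<rho> * x i)"
      using assms(2) by (intro prod_subset_if[symmetric]) auto
    finally show ?thesis using True by (simp add: prod.distrib walsh_def)
  next
    case False
    then obtain i where "i \<in> J" "i \<notin> S" by auto
    then have "(\<Prod>i\<in>{1..n}. ?h i) = 0" using assms(1) by (intro prod_zero) auto
    then show ?thesis using False by simp
  qed
  finally show ?thesis .
qed

text \<open>If \<open>i\<close> lies in only one of the two sets, the factor of coordinate \<open>i\<close> is the mean of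
  the score, which vanishes.\<close>
lemma score_orthogonal:
  assumes "J \<subseteq> {1..n}" "J' \<subseteq> {1..n}" "x \<in> cube n" "\<bar>\<rho>\<bar> < 1"
  shows "noise n \<rho> (\<lambda>y. score \<rho> x J y * score \<rho> x J' y) x
    = (if J = J' then (1 / (1 - \<rho>\<^sup>2)) ^ card J else 0)"
proof -
  have r: "1 - \<rho>\<^sup>2 \<noteq> 0" using assms(4) by (simp add: abs_square_eq_1 abs_if split: if_splits)
  let ?g = "\<lambda>i b. (1 + \<rho> * x i * b) / 2 * (if i \<in> J then (b - \<rho> * x i) / (1 - \<rho>\<^sup>2) else 1)
      * (if i \<in> J' then (b - \<rho> * x i) / (1 - \<rho>\<^sup>2) else 1)"
  let ?h = "\<lambda>i. if i \<in> J then (if i \<in> J' then 1 / (1 - \<rho>\<^sup>2) else 0) else if i \<in> J' then 0 else 1"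
  have "noise n \<rho> (\<lambda>y. score \<rho> x J y * score \<rho> x J' y) x = (\<Sum>y\<in>cube n. \<Prod>i\<in>{1..n}. ?g i (y i))"
    unfolding noise_def noise_kernel_def score_def
    by (simp only: prod_subset_if[OF assms(1)] prod_subset_if[OF assms(2)] prod.distrib mult.assoc)
  also have "\<dots> = (\<Prod>i\<in>{1..n}. ?g i (-1) + ?g i 1)" by (rule sum_cube_prod)
  also have "\<dots> = (\<Prod>i\<in>{1..n}. ?h i)"
  proof (intro prod.cong refl)
    fix i assume i: "i \<in> {1..n}"
    have D: "1 - \<rho>\<^sup>2 = 1 - (\<rho> * x i) * (\<rho> * x i)"
      using cube_coord[OF assms(3) i] by (auto simp: power2_eq_square)
    note m = score_moments[OF D r]
    consider "i \<in> J" "i \<in> J'" | "i \<in> J" "i \<notin> J'" | "i \<notin> J" "i \<in> J'" | "i \<notin> J" "i \<notin> J'"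
      by blast
    then show "?g i (-1) + ?g i 1 = ?h i"
    proof cases
      case 1
      then show ?thesis using m(3) by (simp only: if_True)
    next
      case 2
      then show ?thesis using m(1) by (simp only: if_True if_False mult_1_right)
    next
      case 3
      then show ?thesis using m(1) by (simp only: if_True if_False mult_1_right)
    next
      case 4
      then show ?thesis by (simp add: field_simps)
    qed
  qed
  also have "\<dots> = (if J = J' then (1 / (1 - \<rho>\<^sup>2)) ^ card J else 0)"
  proof (cases "J = J'")
    case True
    then have "(\<Prod>i\<in>{1..n}. ?h i) = (\<Prod>i\<in>{1..n}. if i \<in> J then 1 / (1 - \<rho>\<^sup>2) else 1)"
      by (intro prod.cong) auto
    also have "\<dots> = (\<Prod>i\<in>J. 1 / (1 - \<rho>\<^sup>2))"
      using assms(1) by (intro prod_subset_if[symmetric])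
    finally show ?thesis using True by simp
  next
    case False
    then obtain i where "i \<in> J \<and> i \<notin> J' \<or> i \<in> J' \<and> i \<notin> J" by auto
    then have "(\<Prod>i\<in>{1..n}. ?h i) = 0" using assms(1,2) by (intro prod_zero) auto
    then show ?thesis using False by simp
  qed
  finally show ?thesis .
qed

lemma noise_kernel_sum:
  assumes "x \<in> cube n" "\<bar>\<rho>\<bar> < 1"
  shows "(\<Sum>y\<in>cube n. noise_kernel n \<rho> x y) = 1"
  using noise_score_walsh[of "{}" n "{}" x \<rho>] assms by (simp add: noise_def score_def walsh_def)

lemma noise_sum:
  "noise n \<rho> (\<lambda>y. \<Sum>s\<in>A. c s * g s y) x = (\<Sum>s\<in>A. c s * noise n \<rho> (g s) x)"
  unfolding noise_def by (subst sum_distrib_left, subst sum.swap) (simp add: sum_distrib_left mult_ac)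

lemma noise_derivs_walsh:
  assumes "J \<subseteq> {1..n}" "x \<in> cube n" "\<bar>\<rho>\<bar> < 1"
  shows "noise n \<rho> (derivs J f) x = (\<Sum>S\<in>Pow {1..n}. L2_inner n f (walsh S) *
     (if J \<subseteq> S then \<rho> ^ card (S - J) * walsh (S - J) x else 0))"
proof -
  have "noise n \<rho> (derivs J f) x
      = noise n \<rho> (\<lambda>y. \<Sum>S\<in>Pow {1..n}. L2_inner n f (walsh S) * (if J \<subseteq> S then walsh (S - J) y else 0)) x"
    unfolding noise_def using derivs_walsh_expansion[OF assms(1)] by (intro sum.cong) auto
  also have "\<dots> = (\<Sum>S\<in>Pow {1..n}. L2_inner n f (walsh S) *
      noise n \<rho> (\<lambda>y. if J \<subseteq> S then walsh (S - J) y else 0) x)"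
    by (rule noise_sum)
  also have "\<dots> = (\<Sum>S\<in>Pow {1..n}. L2_inner n f (walsh S) *
     (if J \<subseteq> S then \<rho> ^ card (S - J) * walsh (S - J) x else 0))"
  proof (intro sum.cong refl arg_cong2[where f = "(*)"])
    fix S assume "S \<in> Pow {1..n}"
    then have "noise n \<rho> (walsh (S - J)) x = \<rho> ^ card (S - J) * walsh (S - J) x"
      using noise_score_walsh[of "{}" n "S - J" x \<rho>] assms by (auto simp: score_def)
    then show "noise n \<rho> (\<lambda>y. if J \<subseteq> S then walsh (S - J) y else 0) x
      = (if J \<subseteq> S then \<rho> ^ card (S - J) * walsh (S - J) x else 0)"
      by (cases "J \<subseteq> S") (simp_all add: noise_def)
  qed
  finally show ?thesis .
qed

text \<open>Integration by parts: the derivatives move from \<open>f\<close> to the kernel. Both sides are linear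
  in \<open>f\<close> and agree on Walsh functions.\<close>
lemma noise_derivs_score:
  assumes "J \<subseteq> {1..n}" "x \<in> cube n" "\<bar>\<rho>\<bar> < 1"
  shows "noise n \<rho> (derivs J f) x = noise n \<rho> (\<lambda>y. score \<rho> x J y * f y) x"
proof -
  have "noise n \<rho> (\<lambda>y. score \<rho> x J y * f y) x
      = noise n \<rho> (\<lambda>y. \<Sum>S\<in>Pow {1..n}. L2_inner n f (walsh S) * (score \<rho> x J y * walsh S y)) x"
    unfolding noise_def using walsh_expansion[of _ n f]
    by (intro sum.cong refl) (simp add: sum_distrib_left mult_ac)
  also have "\<dots> = noise n \<rho> (derivs J f) x"
    unfolding noise_sum noise_derivs_walsh[OF assms]
    using noise_score_walsh[OF assms(1) _ assms(2,3)] by (intro sum.cong refl) auto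
  finally show ?thesis by simp
qed

text \<open>Bessel's inequality under the kernel at \<open>x\<close>: the summands are squared inner products of
  \<open>f\<close>, whose \<open>L\<^sup>2\<close> norm is at most one, with orthogonal functions of squared norm
  \<open>(1 / (1 - \<rho>\<^sup>2)) ^ k\<close>. In place of the Cauchy-Schwarz inequality the proof uses
  \<open>2 * f * h \<le> M * f\<^sup>2 + h\<^sup>2 / M\<close> for the combination \<open>h\<close> of the scores that is dual to \<open>f\<close>; the
  constant \<open>M\<close> is the squared norm of a score.\<close>
lemma noise_grad_bound:
  assumes f: "f \<in> cube n \<rightarrow> {-1..1}" and x: "x \<in> cube n" and r: "\<bar>\<rho>\<bar> < 1"
  shows "(\<Sum>J | J \<subseteq> {1..n} \<and> card J = k. (noise n \<rho> (derivs J f) x)\<^sup>2) \<le> (1 / (1 - \<rho>\<^sup>2)) ^ k"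
proof -
  define \<J> where "\<J> = {J. J \<subseteq> {1..n} \<and> card J = k}"
  have fin: "finite \<J>" by (simp add: \<J>_def)
  define c where "c J = noise n \<rho> (derivs J f) x" for J
  define h where "h y = (\<Sum>J\<in>\<J>. c J * score \<rho> x J y)" for y
  define M where "M = (1 / (1 - \<rho>\<^sup>2)) ^ k"
  define V where "V = (\<Sum>J\<in>\<J>. (c J)\<^sup>2)"
  have "1 - \<rho>\<^sup>2 > 0" using r by (simp add: abs_square_less_1)
  then have M: "M > 0" by (simp add: M_def)
  have K: "0 \<le> noise_kernel n \<rho> x y" if "y \<in> cube n" for y
    using noise_kernel_nonneg[OF x that] r by simp
  have fh: "noise n \<rho> (\<lambda>y. f y * h y) x = V"
  proof -
    have "noise n \<rho> (\<lambda>y. f y * h y) x = noise n \<rho> (\<lambda>y. \<Sum>J\<in>\<J>. c J * (score \<rho> x J y * f y)) x"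
      by (simp add: h_def sum_distrib_left mult_ac)
    also have "\<dots> = (\<Sum>J\<in>\<J>. c J * c J)"
      unfolding noise_sum c_def using noise_derivs_score[OF _ x r]
      by (intro sum.cong refl) (auto simp: \<J>_def)
    finally show ?thesis by (simp add: V_def power2_eq_square)
  qed
  have hh: "noise n \<rho> (\<lambda>y. h y * h y) x = M * V"
  proof -
    have "noise n \<rho> (\<lambda>y. h y * h y) x
        = noise n \<rho> (\<lambda>y. \<Sum>J\<in>\<J>. c J * (\<Sum>J'\<in>\<J>. c J' * (score \<rho> x J y * score \<rho> x J' y))) x"
      by (simp add: h_def sum_product sum_distrib_left mult_ac)
    also have "\<dots> = (\<Sum>J\<in>\<J>. c J * (\<Sum>J'\<in>\<J>. c J' * (if J = J' then M else 0)))"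
      unfolding noise_sum
    proof (intro sum.cong refl arg_cong2[where f = "(*)"])
      fix J J' assume "J \<in> \<J>" "J' \<in> \<J>"
      then show "noise n \<rho> (\<lambda>y. score \<rho> x J y * score \<rho> x J' y) x = (if J = J' then M else 0)"
        by (subst score_orthogonal[OF _ _ x r]) (auto simp: \<J>_def M_def)
    qed
    also have "\<dots> = M * V"
      using fin by (simp add: V_def if_distrib sum_distrib_left power2_eq_square mult_ac cong: if_cong)
    finally show ?thesis .
  qed
  (* h is dual to f: both E (f * h) and E (h * h) / M equal V, so 2 * V \<le> M + V. *)
  have "2 * V = noise n \<rho> (\<lambda>y. 2 * (f y * h y)) x"
    by (simp add: noise_def sum_distrib_left mult_ac flip: fh)
  also have "\<dots> \<le> noise n \<rho> (\<lambda>y. M + h y * h y / M) x"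
    unfolding noise_def
  proof (intro sum_mono mult_left_mono K)
    fix y assume y: "y \<in> cube n"
    have "\<bar>f y\<bar> \<le> 1" using f y by (auto simp: Pi_iff abs_le_iff)
    then have "(f y)\<^sup>2 \<le> 1" by (simp add: abs_square_le_1)
    then have "M * (f y)\<^sup>2 \<le> M" using M by simp
    moreover have "0 \<le> (M * f y - h y)\<^sup>2 / M" using M by simp
    then have "2 * (f y * h y) \<le> M * (f y)\<^sup>2 + h y * h y / M"
      using M by (simp add: field_simps power2_eq_square)
    ultimately show "2 * (f y * h y) \<le> M + h y * h y / M" by linarith
  qed
  also have "\<dots> = M + V"
  proof -
    have "noise n \<rho> (\<lambda>y. M + h y * h y / M) x
      = M * (\<Sum>y\<in>cube n. noise_kernel n \<rho> x y) + noise n \<rho> (\<lambda>y. h y * h y) x / M"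
      by (simp add: noise_def algebra_simps sum.distrib sum_distrib_left sum_divide_distrib)
    then show ?thesis using M noise_kernel_sum[OF x r] hh by simp
  qed
  finally show ?thesis by (simp add: V_def c_def M_def \<J>_def)
qed

section \<open>Lp estimates for the smoothed gradient\<close>

text \<open>Young's inequality for the exponents \<open>p\<close> and \<open>p / (p - 1)\<close>, in a form that stays
  meaningful at \<open>p = 1\<close>. It is at the same time the tangent line inequality for the \<open>p\<close>-th power
  at \<open>b\<close>, which is how Jensen's inequality uses it.\<close>
lemma young_powr:
  fixes a b p :: real
  assumes "0 \<le> a" "0 \<le> b" "1 \<le> p"
  shows "a * b powr (p - 1) \<le> a powr p / p + (1 - 1 / p) * b powr p"
proof (cases "a = 0 \<or> b = 0")
  case True
  then show ?thesis using assms by auto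
next
  case False
  then have ab: "a > 0" "b > 0" using assms by auto
  have "(a powr p) powr (1 / p) * (b powr p) powr (1 - 1 / p) \<le> 1 / p * a powr p + (1 - 1 / p) * b powr p"
    using assms ab by (intro Youngs_inequality_0) auto
  moreover have "p * (1 - 1 / p) = p - 1" using assms by (simp add: field_simps)
  ultimately show ?thesis using ab assms by (simp add: powr_powr)
qed

text \<open>Average the tangent line inequality at the mean. Arguing this way covers points \<open>z y = 0\<close>
  on the boundary of the half-line as well.\<close>
lemma jensen_powr:
  fixes w z :: "'a \<Rightarrow> real"
  assumes "\<And>y. y \<in> A \<Longrightarrow> 0 \<le> w y" "(\<Sum>y\<in>A. w y) = 1" "\<And>y. y \<in> A \<Longrightarrow> 0 \<le> z y" "1 \<le> p"
  shows "(\<Sum>y\<in>A. w y * z y) powr p \<le> (\<Sum>y\<in>A. w y * z y powr p)"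
proof -
  define m where "m = (\<Sum>y\<in>A. w y * z y)"
  have m: "0 \<le> m" using assms by (auto simp: m_def intro!: sum_nonneg)
  have "m powr p = m * m powr (p - 1)"
    using m powr_mult_base[of m "p - 1"] by simp
  also have "\<dots> = (\<Sum>y\<in>A. w y * (z y * m powr (p - 1)))"
    by (simp add: m_def sum_distrib_right mult_ac)
  also have "\<dots> \<le> (\<Sum>y\<in>A. w y * (z y powr p / p + (1 - 1 / p) * m powr p))"
    using assms m by (intro sum_mono mult_left_mono young_powr) auto
  also have "\<dots> = (\<Sum>y\<in>A. w y * z y powr p) / p + (1 - 1 / p) * m powr p"
    by (simp add: distrib_left sum.distrib sum_divide_distrib assms(2) flip: sum_distrib_right)
  finally have "m powr p / p \<le> (\<Sum>y\<in>A. w y * z y powr p) / p"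
    by (simp add: left_diff_distrib)
  then show ?thesis using assms(4) by (simp add: m_def divide_le_cancel)
qed

lemma L2_set_sum_le:
  assumes "finite A" "\<And>y. y \<in> A \<Longrightarrow> 0 \<le> w y"
  shows "L2_set (\<lambda>J. \<Sum>y\<in>A. w y * a y J) I \<le> (\<Sum>y\<in>A. w y * L2_set (a y) I)"
  using assms
proof (induction A rule: finite_induct)
  case (insert y A)
  have "L2_set (\<lambda>J. \<Sum>y\<in>insert y A. w y * a y J) I
      \<le> L2_set (\<lambda>J. w y * a y J) I + L2_set (\<lambda>J. \<Sum>y\<in>A. w y * a y J) I"
    using insert.hyps L2_set_triangle_ineq by simp
  also have "\<dots> \<le> w y * L2_set (a y) I + (\<Sum>y\<in>A. w y * L2_set (a y) I)"
    using insert by (simp add: L2_set_right_distrib)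
  finally show ?case using insert.hyps by simp
qed (simp add: L2_set_def)

lemma grad_norm_L2_set:
  "grad_norm n k f x = L2_set (\<lambda>J. derivs J f x) {J. J \<subseteq> {1..n} \<and> card J = k}"
  by (simp add: grad_norm_def L2_set_def)

text \<open>The kernel is symmetric and its rows sum to one, so it averages both in \<open>y\<close> and in \<open>x\<close>:
  the first fact, the triangle inequality and Jensen's inequality give the pointwise bound, the
  second lets the sum over \<open>x\<close> absorb the kernel.\<close>
lemma noise_grad_Lp_contraction:
  assumes "\<bar>\<rho>\<bar> < 1" "1 \<le> p"
  shows "(\<Sum>x\<in>cube n. L2_set (\<lambda>J. noise n \<rho> (derivs J f) x) {J. J \<subseteq> {1..n} \<and> card J = k} powr p)
    \<le> (\<Sum>x\<in>cube n. grad_norm n k f x powr p)"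
proof -
  let ?I = "{J. J \<subseteq> {1..n} \<and> card J = k}"
  have nn: "0 \<le> noise_kernel n \<rho> x y" if "x \<in> cube n" "y \<in> cube n" for x y
    using noise_kernel_nonneg[OF that] assms(1) by simp
  have "(\<Sum>x\<in>cube n. L2_set (\<lambda>J. noise n \<rho> (derivs J f) x) ?I powr p)
      \<le> (\<Sum>x\<in>cube n. \<Sum>y\<in>cube n. noise_kernel n \<rho> x y * grad_norm n k f y powr p)"
  proof (intro sum_mono)
    fix x assume x: "x \<in> cube n"
    have "L2_set (\<lambda>J. noise n \<rho> (derivs J f) x) ?I \<le> (\<Sum>y\<in>cube n. noise_kernel n \<rho> x y * grad_norm n k f y)"
      unfolding noise_def grad_norm_L2_set
      using L2_set_sum_le[OF finite_cube nn[OF x], where a = "\<lambda>y J. derivs J f y"] by simp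
    then have "L2_set (\<lambda>J. noise n \<rho> (derivs J f) x) ?I powr p
        \<le> (\<Sum>y\<in>cube n. noise_kernel n \<rho> x y * grad_norm n k f y) powr p"
      using assms(2) by (intro powr_mono2) (auto intro: L2_set_nonneg)
    also have "\<dots> \<le> (\<Sum>y\<in>cube n. noise_kernel n \<rho> x y * grad_norm n k f y powr p)"
      using nn[OF x] noise_kernel_sum[OF x assms(1)] assms(2)
      by (intro jensen_powr) (auto simp: grad_norm_L2_set intro: L2_set_nonneg)
    finally show "L2_set (\<lambda>J. noise n \<rho> (derivs J f) x) ?I powr p
      \<le> (\<Sum>y\<in>cube n. noise_kernel n \<rho> x y * grad_norm n k f y powr p)" .
  qed
  also have "\<dots> = (\<Sum>y\<in>cube n. (\<Sum>x\<in>cube n. noise_kernel n \<rho> y x) * grad_norm n k f y powr p)"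
    by (subst sum.swap) (simp add: sum_distrib_right noise_kernel_sym)
  also have "\<dots> = (\<Sum>y\<in>cube n. grad_norm n k f y powr p)"
    using noise_kernel_sum assms(1) by (intro sum.cong) simp_all
  finally show ?thesis .
qed

text \<open>Each \<open>S\<close> of size at least \<open>k\<close> is counted once for each of its subsets \<open>J\<close> of size \<open>k\<close>,
  and smoothing \<open>D J\<close> of the Walsh function of \<open>S\<close> costs \<open>\<rho> ^ (card S - k)\<close>.\<close>
lemma grad_noise_spectral:
  assumes "\<bar>\<rho>\<bar> < 1"
  shows "(\<Sum>x\<in>cube n. \<Sum>J | J \<subseteq> {1..n} \<and> card J = k. derivs J f x * noise n \<rho> (derivs J f) x) / 2 ^ n
    = (\<Sum>S | S \<subseteq> {1..n} \<and> k \<le> card S. real (card S choose k) * \<rho> ^ (card S - k) * (L2_inner n f (walsh S))\<^sup>2)"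
proof -
  let ?I = "{J. J \<subseteq> {1..n} \<and> card J = k}"
  let ?a = "\<lambda>S. L2_inner n f (walsh S)"
  have J: "(\<Sum>x\<in>cube n. derivs J f x * noise n \<rho> (derivs J f) x) / 2 ^ n
      = (\<Sum>S\<in>Pow {1..n}. if J \<subseteq> S then \<rho> ^ (card S - k) * (?a S)\<^sup>2 else 0)" if "J \<in> ?I" for J
  proof -
    have JI: "J \<subseteq> {1..n}" "card J = k" "finite J" using that finite_subset by auto
    have "(\<Sum>x\<in>cube n. derivs J f x * noise n \<rho> (derivs J f) x) / 2 ^ n
        = (\<Sum>x\<in>cube n. \<Sum>S\<in>Pow {1..n}. ?a S * (if J \<subseteq> S then \<rho> ^ card (S - J) * (derivs J f x * walsh (S - J) x) else 0)) / 2 ^ n"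
      using noise_derivs_walsh[OF JI(1) _ assms]
      by (intro arg_cong2[where f = "(/)"] sum.cong refl) (simp add: sum_distrib_left if_distrib mult_ac cong: if_cong)
    also have "\<dots> = (\<Sum>S\<in>Pow {1..n}. (\<Sum>x\<in>cube n. ?a S * (if J \<subseteq> S then \<rho> ^ card (S - J) * (derivs J f x * walsh (S - J) x) else 0)) / 2 ^ n)"
      unfolding sum_divide_distrib by (rule sum.swap)
    also have "\<dots> = (\<Sum>S\<in>Pow {1..n}. if J \<subseteq> S then \<rho> ^ (card S - k) * (?a S)\<^sup>2 else 0)"
    proof (intro sum.cong refl)
      fix S assume S: "S \<in> Pow {1..n}"
      show "(\<Sum>x\<in>cube n. ?a S * (if J \<subseteq> S then \<rho> ^ card (S - J) * (derivs J f x * walsh (S - J) x) else 0)) / 2 ^ n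
        = (if J \<subseteq> S then \<rho> ^ (card S - k) * (?a S)\<^sup>2 else 0)"
      proof (cases "J \<subseteq> S")
        case True
        have "finite S" using S finite_subset by auto
        then have "L2_inner n (derivs J f) (walsh (S - J)) = ?a (J \<union> (S - J))"
          using JI by (intro L2_inner_derivs) auto
        moreover have "J \<union> (S - J) = S" using True by auto
        moreover have "(\<Sum>x\<in>cube n. ?a S * (if J \<subseteq> S then \<rho> ^ card (S - J) * (derivs J f x * walsh (S - J) x) else 0)) / 2 ^ n
            = ?a S * (\<rho> ^ card (S - J) * L2_inner n (derivs J f) (walsh (S - J)))"
          using True
          by (simp add: L2_inner_def[of n "derivs J f"] cube_expectation flip: sum_distrib_left)
        ultimately show ?thesis
          using True JI by (simp add: card_Diff_subset power2_eq_square)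
      qed simp
    qed
    finally show ?thesis .
  qed
  have "(\<Sum>x\<in>cube n. \<Sum>J\<in>?I. derivs J f x * noise n \<rho> (derivs J f) x) / 2 ^ n
      = (\<Sum>J\<in>?I. (\<Sum>x\<in>cube n. derivs J f x * noise n \<rho> (derivs J f) x) / 2 ^ n)"
    by (subst sum.swap) (simp add: sum_divide_distrib)
  also have "\<dots> = (\<Sum>J\<in>?I. \<Sum>S\<in>Pow {1..n}. if J \<subseteq> S then \<rho> ^ (card S - k) * (?a S)\<^sup>2 else 0)"
    using J by (intro sum.cong) auto
  also have "\<dots> = (\<Sum>S\<in>Pow {1..n}. \<Sum>J\<in>?I. if J \<subseteq> S then \<rho> ^ (card S - k) * (?a S)\<^sup>2 else 0)"
    by (rule sum.swap)
  also have "\<dots> = (\<Sum>S\<in>Pow {1..n}. real (card S choose k) * \<rho> ^ (card S - k) * (?a S)\<^sup>2)"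
  proof (intro sum.cong refl)
    fix S assume S: "S \<in> Pow {1..n}"
    then have "finite S" using finite_subset by auto
    moreover have "{J \<in> ?I. J \<subseteq> S} = {J. J \<subseteq> S \<and> card J = k}" using S by auto
    ultimately have "card {J \<in> ?I. J \<subseteq> S} = card S choose k" by (simp add: n_subsets)
    then show "(\<Sum>J\<in>?I. if J \<subseteq> S then \<rho> ^ (card S - k) * (?a S)\<^sup>2 else 0)
      = real (card S choose k) * \<rho> ^ (card S - k) * (?a S)\<^sup>2"
      by (simp flip: sum.inter_filter)
  qed
  also have "\<dots> = (\<Sum>S | S \<subseteq> {1..n} \<and> k \<le> card S. real (card S choose k) * \<rho> ^ (card S - k) * (?a S)\<^sup>2)"
    by (intro sum.mono_neutral_right) auto
  finally show ?thesis .
qed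

text \<open>With \<open>a = \<bar>\<nabla>\<^sup>k f\<bar>\<close> and \<open>b = \<bar>P \<rho> (\<nabla>\<^sup>k f)\<bar>\<close>, the integrand of the spectral formula is at
  most \<open>a * b = b powr (2 - p) * (a * b powr (p - 1))\<close>. The first factor is bounded pointwise
  and the second is controlled through Young's inequality by \<open>a powr p\<close> and \<open>b powr p\<close>, the
  latter having at most the average of the former by contractivity. Splitting off
  the power \<open>2 - p\<close> avoids the dual exponent of \<open>p\<close>, which is infinite at \<open>p = 1\<close>.\<close>
lemma noise_energy_bound:
  assumes f: "f \<in> cube n \<rightarrow> {-1..1}" and r: "\<bar>\<rho>\<bar> < 1" and p: "1 \<le> p" "p \<le> 2"
  shows "(\<Sum>S | S \<subseteq> {1..n} \<and> k \<le> card S. real (card S choose k) * \<rho> ^ (card S - k) * (L2_inner n f (walsh S))\<^sup>2)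
    \<le> ((1 - \<rho>\<^sup>2) powr (p / 2 - 1)) ^ k * ((\<Sum>x\<in>cube n. grad_norm n k f x powr p) / 2 ^ n)"
proof -
  let ?I = "{J. J \<subseteq> {1..n} \<and> card J = k}"
  define a where "a x = grad_norm n k f x" for x
  define b where "b x = L2_set (\<lambda>J. noise n \<rho> (derivs J f) x) ?I" for x
  define L where "L = ((1 - \<rho>\<^sup>2) powr (p / 2 - 1)) ^ k"
  have r': "1 - \<rho>\<^sup>2 > 0" using r by (simp add: abs_square_less_1)
  have a: "0 \<le> a x" for x by (simp add: a_def grad_norm_L2_set L2_set_nonneg)
  have b: "0 \<le> b x" for x by (simp add: b_def L2_set_nonneg)
  have L: "0 \<le> L" by (simp add: L_def)
  have bL: "b x powr (2 - p) \<le> L" if x: "x \<in> cube n" for x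
  proof -
    have "b x \<le> (1 - \<rho>\<^sup>2) powr (- real k / 2)"
    proof -
      have "b x \<le> sqrt ((1 / (1 - \<rho>\<^sup>2)) ^ k)"
        unfolding b_def L2_set_def using noise_grad_bound[OF f x r] by (rule real_sqrt_le_mono)
      also have "(1 / (1 - \<rho>\<^sup>2)) ^ k = (1 - \<rho>\<^sup>2) powr (- real k)"
        using r' by (simp add: powr_minus powr_realpow power_divide inverse_eq_divide)
      also have "sqrt \<dots> = (1 - \<rho>\<^sup>2) powr (- real k / 2)"
        by (simp add: powr_powr flip: powr_half_sqrt)
      finally show ?thesis .
    qed
    then have "b x powr (2 - p) \<le> ((1 - \<rho>\<^sup>2) powr (- real k / 2)) powr (2 - p)"
      using p b by (intro powr_mono2) auto
    also have "\<dots> = (1 - \<rho>\<^sup>2) powr ((p / 2 - 1) * real k)"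
    proof -
      have "- real k / 2 * (2 - p) = (p / 2 - 1) * real k" by (simp add: field_simps)
      then show ?thesis by (simp only: powr_powr)
    qed
    also have "\<dots> = L" using r' by (simp add: L_def powr_powr flip: powr_realpow)
    finally show ?thesis .
  qed
  have "(\<Sum>J\<in>?I. derivs J f x * noise n \<rho> (derivs J f) x)
      \<le> L * (a x powr p / p + (1 - 1 / p) * b x powr p)" if x: "x \<in> cube n" for x
  proof -
    have "(\<Sum>J\<in>?I. derivs J f x * noise n \<rho> (derivs J f) x)
        \<le> (\<Sum>J\<in>?I. \<bar>derivs J f x\<bar> * \<bar>noise n \<rho> (derivs J f) x\<bar>)"
      by (intro sum_mono) (metis abs_ge_self abs_mult)
    also have "\<dots> \<le> a x * b x"
      unfolding a_def b_def grad_norm_L2_set by (rule L2_set_mult_ineq)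
    also have "\<dots> = b x powr (2 - p) * (a x * b x powr (p - 1))"
      using b[of x] by (cases "b x = 0") (auto simp flip: powr_add)
    also have "\<dots> \<le> L * (a x powr p / p + (1 - 1 / p) * b x powr p)"
      using bL[OF x] young_powr[OF a b p(1)] L a by (intro mult_mono) auto
    finally show ?thesis .
  qed
  then have "(\<Sum>x\<in>cube n. \<Sum>J\<in>?I. derivs J f x * noise n \<rho> (derivs J f) x)
      \<le> (\<Sum>x\<in>cube n. L * (a x powr p / p + (1 - 1 / p) * b x powr p))"
    by (rule sum_mono)
  also have "\<dots> = L * ((\<Sum>x\<in>cube n. a x powr p) / p + (1 - 1 / p) * (\<Sum>x\<in>cube n. b x powr p))"
    by (simp add: sum.distrib sum_divide_distrib flip: sum_distrib_left)
  also have "\<dots> \<le> L * ((\<Sum>x\<in>cube n. a x powr p) / p + (1 - 1 / p) * (\<Sum>x\<in>cube n. a x powr p))"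
    using L p noise_grad_Lp_contraction[OF r p(1), of n f k]
    by (intro mult_left_mono add_left_mono) (auto simp: a_def b_def)
  also have "\<dots> = L * (\<Sum>x\<in>cube n. a x powr p)" by (simp add: algebra_simps)
  finally have "(\<Sum>x\<in>cube n. \<Sum>J\<in>?I. derivs J f x * noise n \<rho> (derivs J f) x) / 2 ^ n
      \<le> L * (\<Sum>x\<in>cube n. a x powr p) / 2 ^ n" by (simp add: divide_right_mono)
  then show ?thesis
    unfolding grad_noise_spectral[OF r] by (simp add: L_def a_def)
qed

section \<open>The primitive given by the incomplete Beta integral\<close>

lemma beta_kernel_at_half:
  fixes \<theta> p :: real
  assumes "0 < \<theta>" "\<theta> < 2"
  shows "2 powr (p - 1) * ((\<theta> / 2) powr (p / 2 - 1) * (1 - \<theta> / 2) powr (p / 2 - 1) / 2)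
    = (\<theta> * (2 - \<theta>)) powr (p / 2 - 1)"
proof -
  have "(\<theta> / 2) powr (p / 2 - 1) * (1 - \<theta> / 2) powr (p / 2 - 1)
      = (\<theta> / 2 * (1 - \<theta> / 2)) powr (p / 2 - 1)"
    by (intro powr_mult[symmetric])
  also have "\<theta> / 2 * (1 - \<theta> / 2) = \<theta> * (2 - \<theta>) / 4" by (simp add: field_simps)
  also have "(\<theta> * (2 - \<theta>) / 4) powr (p / 2 - 1) = (\<theta> * (2 - \<theta>)) powr (p / 2 - 1) / 4 powr (p / 2 - 1)"
    using assms by (simp add: powr_divide)
  also have "4 powr (p / 2 - 1) = 2 powr (p - 2)"
  proof -
    have "4 powr (p / 2 - 1) = (2 powr 2) powr (p / 2 - 1)" by simp
    also have "\<dots> = 2 powr (p - 2)" by (simp only: powr_powr) (simp add: algebra_simps)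
    finally show ?thesis .
  qed
  finally show ?thesis
    by (simp add: powr_diff)
qed

text \<open>The primitive of \<open>(\<theta> * (2 - \<theta>)) powr (p / 2 - 1)\<close> that vanishes at \<open>\<theta> = 0\<close>. The
  variable of the Beta integral is \<open>t = \<theta> / 2\<close>: for \<open>\<rho> = 1 - \<theta>\<close> one has
  \<open>1 - \<rho>\<^sup>2 = \<theta> * (2 - \<theta>) = 4 * t * (1 - t)\<close>.\<close>
definition Beta_half :: "real \<Rightarrow> real \<Rightarrow> real" where
  "Beta_half p \<theta> = 2 powr (p - 1) * incomplete_Beta (\<theta> / 2) (p / 2) (p / 2)"

lemma C_const_Beta_half: "C_const p = 1 / Beta_half p 1"
proof -
  have "2 powr (1 - p) = 1 / 2 powr (p - 1)"
    using powr_minus_divide[of 2 "p - 1"] by simp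
  then show ?thesis by (simp add: C_const_def Beta_half_def)
qed

lemma Beta_half_0: "Beta_half p 0 = 0"
  by (simp add: Beta_half_def incomplete_Beta_def)

lemma Beta_half_continuous:
  assumes "0 < p"
  shows "continuous_on {0..1} (Beta_half p)"
proof -
  have "continuous_on {0..1} (\<lambda>x. incomplete_Beta x (p / 2) (p / 2))"
    unfolding incomplete_Beta_def
    using assms by (intro indefinite_integral_continuous_1 integrable_Beta') auto
  then have "continuous_on {0..1} (\<lambda>\<theta>. incomplete_Beta (\<theta> / 2) (p / 2) (p / 2))"
    by (rule continuous_on_compose2) (auto intro!: continuous_intros)
  then show ?thesis unfolding Beta_half_def by (intro continuous_intros)
qed

lemma Beta_half_deriv:
  assumes "0 < p" "0 < \<theta>" "\<theta> < 2"
  shows "(Beta_half p has_real_derivative (\<theta> * (2 - \<theta>)) powr (p / 2 - 1)) (at \<theta>)"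
proof -
  define g where "g t = t powr (p / 2 - 1) * (1 - t) powr (p / 2 - 1)" for t :: real
  define x where "x = \<theta> / 2"
  have x: "0 < x" "x < 1" using assms by (auto simp: x_def)
  have "continuous (at x within {0..1} - {}) g"
    unfolding g_def using x by (intro continuous_intros) auto
  then have "((\<lambda>u. integral {0..u} g) has_vector_derivative g x) (at x within {0..1} - {})"
    unfolding g_def using x assms(1)
    by (intro integral_has_vector_derivative_continuous_at integrable_Beta') auto
  then have "((\<lambda>u. incomplete_Beta u (p / 2) (p / 2)) has_real_derivative g x) (at x)"
    using x at_within_interior[of x "{0..1}"]
    by (simp add: has_real_derivative_iff_has_vector_derivative incomplete_Beta_def g_def[abs_def])
  then have "((\<lambda>\<theta>. incomplete_Beta (\<theta> / 2) (p / 2) (p / 2)) has_real_derivative g x * (1 / 2)) (at \<theta>)"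
    unfolding x_def by (rule DERIV_chain2) (auto intro!: derivative_eq_intros)
  then have "(Beta_half p has_real_derivative 2 powr (p - 1) * (g x * (1 / 2))) (at \<theta>)"
    unfolding Beta_half_def by (rule DERIV_cmult)
  also have "2 powr (p - 1) * (g x * (1 / 2)) = (\<theta> * (2 - \<theta>)) powr (p / 2 - 1)"
    using beta_kernel_at_half[OF assms(2,3)] by (simp add: g_def x_def)
  finally show ?thesis .
qed

text \<open>By the mean value theorem \<open>Beta_half p \<theta>\<close> is \<open>\<theta>\<close> times the derivative at some earlier
  point, and the derivative decreases because \<open>\<theta> * (2 - \<theta>)\<close> increases up to \<open>\<theta> = 1\<close> and
  the exponent is not positive.\<close>
lemma Beta_half_ge:
  assumes "0 < p" "p \<le> 2" "0 < \<theta>" "\<theta> \<le> 1"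
  shows "\<theta> * (\<theta> * (2 - \<theta>)) powr (p / 2 - 1) \<le> Beta_half p \<theta>"
proof -
  have "continuous_on {0..\<theta>} (Beta_half p)"
    using Beta_half_continuous[OF assms(1)] by (rule continuous_on_subset) (use assms in auto)
  moreover have "(Beta_half p has_derivative (*) ((t * (2 - t)) powr (p / 2 - 1))) (at t)"
    if "0 < t" "t < \<theta>" for t
    using Beta_half_deriv[OF assms(1), of t] that assms by (simp add: has_field_derivative_def)
  ultimately obtain \<xi> where \<xi>: "0 < \<xi>" "\<xi> < \<theta>"
      "Beta_half p \<theta> - Beta_half p 0 = (\<xi> * (2 - \<xi>)) powr (p / 2 - 1) * (\<theta> - 0)"
    using mvt[OF assms(3), of "Beta_half p" "\<lambda>t. (*) ((t * (2 - t)) powr (p / 2 - 1))"] by blast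
  have "0 \<le> (\<theta> - \<xi>) * (2 - \<theta> - \<xi>)" using \<xi> assms by simp
  then have "\<xi> * (2 - \<xi>) \<le> \<theta> * (2 - \<theta>)" by (simp add: algebra_simps)
  then have "(\<theta> * (2 - \<theta>)) powr (p / 2 - 1) \<le> (\<xi> * (2 - \<xi>)) powr (p / 2 - 1)"
    using \<xi> assms by (intro powr_mono2') auto
  then show ?thesis using \<xi>(3) assms by (simp add: Beta_half_0 mult.commute)
qed

section \<open>From the bound at every noise level to the total weight\<close>

text \<open>The sum is the probability that a binomial variable with \<open>m\<close> trials and success
  probability \<open>\<theta>\<close> is below \<open>k\<close>; its derivative telescopes, leaving the last term only.\<close>
lemma binomial_cdf_deriv:
  fixes \<theta> :: real
  assumes "k \<le> m"
  shows "((\<lambda>\<theta>. \<Sum>j<k. real (m choose j) * \<theta> ^ j * (1 - \<theta>) ^ (m - j)) has_real_derivative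
    - (real k * real (m choose k) * \<theta> ^ (k - 1) * (1 - \<theta>) ^ (m - k))) (at \<theta>)"
  using assms
proof (induction k)
  case (Suc k)
  have "Suc k * (m choose Suc k) = (m - k) * (m choose k)"
    using binomial_absorb_comp[of m k] times_binomial_minus1_eq[of "Suc k" m] by simp
  then have b: "real (Suc k) * real (m choose Suc k) = real (m - k) * real (m choose k)"
    by (simp only: flip: of_nat_mult)
  have "((\<lambda>\<theta>. real (m choose k) * \<theta> ^ k * (1 - \<theta>) ^ (m - k)) has_real_derivative
      real k * real (m choose k) * \<theta> ^ (k - 1) * (1 - \<theta>) ^ (m - k)
      - real (m - k) * real (m choose k) * \<theta> ^ k * (1 - \<theta>) ^ (m - k - 1)) (at \<theta>)"
    by (auto intro!: derivative_eq_intros simp: algebra_simps)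
  from DERIV_add[OF Suc.IH this] Suc.prems
  have "((\<lambda>\<theta>. \<Sum>j<Suc k. real (m choose j) * \<theta> ^ j * (1 - \<theta>) ^ (m - j)) has_real_derivative
      - (real (m - k) * real (m choose k) * \<theta> ^ k * (1 - \<theta>) ^ (m - k - 1))) (at \<theta>)"
    by simp
  then show ?case unfolding b[symmetric] by simp
qed simp

text \<open>The weights are recovered by integrating the hypothesis \<open>bound\<close> against
  \<open>k * \<theta> ^ (k - 1)\<close>. To avoid integrals, \<open>G \<theta>\<close> is the sum of the weights, each multiplied by
  the probability that a binomial variable with parameters \<open>d S\<close> and \<open>\<theta>\<close> is at least \<open>k\<close>. It
  grows from zero to the full sum, and \<open>A * H ^ k - G\<close> is nondecreasing: the hypothesis
  \<open>\<theta> * h \<le> H\<close> turns the factor \<open>(\<theta> * h) ^ (k - 1)\<close> in the derivative of \<open>G\<close> into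
  \<open>H ^ (k - 1)\<close>.\<close>
lemma sum_le_of_binomial_bound:
  fixes w :: "'a \<Rightarrow> real" and d :: "'a \<Rightarrow> nat" and H h :: "real \<Rightarrow> real"
  assumes k: "0 < k" and d: "\<And>S. S \<in> T \<Longrightarrow> k \<le> d S" and A: "0 \<le> A"
    and H: "continuous_on {0..1} H" "H 0 = 0"
      "\<And>\<theta>. 0 < \<theta> \<Longrightarrow> \<theta> < 1 \<Longrightarrow> (H has_real_derivative h \<theta>) (at \<theta>)"
    and h: "\<And>\<theta>. 0 < \<theta> \<Longrightarrow> \<theta> < 1 \<Longrightarrow> 0 \<le> h \<theta>"
      "\<And>\<theta>. 0 < \<theta> \<Longrightarrow> \<theta> < 1 \<Longrightarrow> \<theta> * h \<theta> \<le> H \<theta>"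
    and bound: "\<And>\<theta>. 0 < \<theta> \<Longrightarrow> \<theta> < 1 \<Longrightarrow>
      (\<Sum>S\<in>T. w S * (real (d S choose k) * (1 - \<theta>) ^ (d S - k))) \<le> A * h \<theta> ^ k"
  shows "(\<Sum>S\<in>T. w S) \<le> A * H 1 ^ k"
proof -
  define R where "R S \<theta> = 1 - (\<Sum>j<k. real (d S choose j) * \<theta> ^ j * (1 - \<theta>) ^ (d S - j))" for S \<theta>
  define G where "G \<theta> = (\<Sum>S\<in>T. w S * R S \<theta>)" for \<theta>
  have "(\<Sum>j<k. real (d S choose j) * 0 ^ j * (1 - 0) ^ (d S - j)) = (\<Sum>j\<in>{0::nat}. 1)" for S
    using k by (intro sum.mono_neutral_cong_right) auto
  then have G0: "G 0 = 0" by (simp add: G_def R_def)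
  have "R S 1 = 1" if "S \<in> T" for S using d[OF that] by (auto simp: R_def intro!: sum.neutral)
  then have G1: "G 1 = (\<Sum>S\<in>T. w S)" by (simp add: G_def)
  have Gd: "(G has_real_derivative
      real k * \<theta> ^ (k - 1) * (\<Sum>S\<in>T. w S * (real (d S choose k) * (1 - \<theta>) ^ (d S - k)))) (at \<theta>)" for \<theta>
  proof -
    have "(R S has_real_derivative real k * real (d S choose k) * \<theta> ^ (k - 1) * (1 - \<theta>) ^ (d S - k)) (at \<theta>)"
      if "S \<in> T" for S
      using DERIV_diff[OF DERIV_const binomial_cdf_deriv[OF d[OF that]]] by (simp add: R_def[abs_def])
    then have "(G has_real_derivative
        (\<Sum>S\<in>T. w S * (real k * real (d S choose k) * \<theta> ^ (k - 1) * (1 - \<theta>) ^ (d S - k)))) (at \<theta>)"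
      unfolding G_def[abs_def] by (intro DERIV_sum DERIV_cmult) auto
    then show ?thesis by (simp add: sum_distrib_left mult_ac)
  qed
  have "A * H 0 ^ k - G 0 \<le> A * H 1 ^ k - G 1"
  proof (rule DERIV_nonneg_imp_increasing_open[where f = "\<lambda>\<theta>. A * H \<theta> ^ k - G \<theta>"])
    have "continuous_on {0..1} G"
      using DERIV_isCont[OF Gd] by (intro continuous_at_imp_continuous_on) blast
    then show "continuous_on {0..1} (\<lambda>\<theta>. A * H \<theta> ^ k - G \<theta>)"
      using H(1) by (intro continuous_intros)
    fix \<theta> :: real assume \<theta>: "0 < \<theta>" "\<theta> < 1"
    let ?E = "\<Sum>S\<in>T. w S * (real (d S choose k) * (1 - \<theta>) ^ (d S - k))"
    have "((\<lambda>\<theta>. A * H \<theta> ^ k - G \<theta>) has_real_derivative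
        A * (real k * H \<theta> ^ (k - 1) * h \<theta>) - real k * \<theta> ^ (k - 1) * ?E) (at \<theta>)"
      using H(3)[OF \<theta>] Gd by (auto intro!: derivative_eq_intros)
    moreover have "real k * \<theta> ^ (k - 1) * ?E \<le> A * (real k * H \<theta> ^ (k - 1) * h \<theta>)"
    proof -
      have "real k * \<theta> ^ (k - 1) * ?E \<le> real k * \<theta> ^ (k - 1) * (A * h \<theta> ^ k)"
        using bound[OF \<theta>] \<theta> by (intro mult_left_mono) auto
      also have "h \<theta> ^ k = h \<theta> * h \<theta> ^ (k - 1)"
        using k by (simp flip: power_Suc)
      also have "real k * \<theta> ^ (k - 1) * (A * (h \<theta> * h \<theta> ^ (k - 1)))
          = A * (real k * (\<theta> * h \<theta>) ^ (k - 1) * h \<theta>)"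
        by (simp add: power_mult_distrib mult_ac)
      also have "\<dots> \<le> A * (real k * H \<theta> ^ (k - 1) * h \<theta>)"
        using A h[OF \<theta>] \<theta> by (intro mult_left_mono mult_right_mono power_mono) auto
      finally show ?thesis .
    qed
    ultimately show "\<exists>y. ((\<lambda>\<theta>. A * H \<theta> ^ k - G \<theta>) has_real_derivative y) (at \<theta>) \<and> 0 \<le> y"
      by (intro exI conjI) auto
  qed simp
  then show ?thesis using G0 G1 H(2) k by (simp add: zero_power)
qed

section \<open>The gradient inequality\<close>

lemma Beta_half_1_pos:
  assumes "0 < p" "p \<le> 2"
  shows "0 < Beta_half p 1"
  using Beta_half_ge[OF assms, of 1] by simp

lemma Lp_norm_powr:
  assumes "p \<noteq> 0" "\<And>x. 0 \<le> g x"
  shows "Lp_norm n p g powr p = (\<Sum>x\<in>cube n. g x powr p) / 2 ^ n"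
proof -
  have "0 \<le> (\<Sum>x\<in>cube n. g x powr p)" by (intro sum_nonneg) auto
  then show ?thesis using assms by (simp add: Lp_norm_def cube_expectation powr_powr)
qed

theorem theorem1p1:
  fixes n k :: nat and f :: "(nat \<Rightarrow> real) \<Rightarrow> real" and p :: real
  assumes "n \<ge> 1"
    and "k \<in> {0..n}"
    and "f \<in> cube n \<rightarrow> {-1..1}"
    and "p \<in> {1..2}"
  shows "Lp_norm n p (grad_norm n k f) powr p \<ge> C_const p ^ k * high_weight n k f"
proof -
  have p: "1 \<le> p" "p \<le> 2" using assms(4) by auto
  define A where "A = (\<Sum>x\<in>cube n. grad_norm n k f x powr p) / 2 ^ n"
  have A: "0 \<le> A" unfolding A_def by (intro divide_nonneg_nonneg sum_nonneg) auto
  have norm: "Lp_norm n p (grad_norm n k f) powr p = A"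
    unfolding A_def using p by (intro Lp_norm_powr) (auto simp: grad_norm_L2_set intro: L2_set_nonneg)
  have B: "0 < Beta_half p 1" using p by (intro Beta_half_1_pos) auto
  have "high_weight n k f \<le> A * Beta_half p 1 ^ k"
  proof (cases "k = 0")
    case True
    have "high_weight n 0 f = L2_inner n f f"
      unfolding high_weight_eq parseval by (intro sum.cong) auto
    also have "\<dots> \<le> A"
      unfolding L2_inner_def cube_expectation A_def
    proof (intro divide_right_mono sum_mono)
      fix x assume "x \<in> cube n"
      then have "f x \<in> {-1..1}" using assms(3) by auto
      then have f1: "\<bar>f x\<bar> \<le> 1" by auto
      have "{J. J \<subseteq> {1..n} \<and> card J = 0} = {{}}" by (auto dest: finite_subset)
      then have "grad_norm n k f x = \<bar>f x\<bar>" using True by (simp add: grad_norm_def)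
      moreover have "f x * f x = \<bar>f x\<bar> powr 2" by (simp add: power2_eq_square)
      moreover have "\<bar>f x\<bar> powr 2 \<le> \<bar>f x\<bar> powr p" using f1 p by (intro powr_mono') auto
      ultimately show "f x * f x \<le> grad_norm n k f x powr p" by simp
    qed simp
    finally show ?thesis using True by simp
  next
    case False
    show ?thesis
      unfolding high_weight_eq
    proof (rule sum_le_of_binomial_bound[where d = card and h = "\<lambda>\<theta>. (\<theta> * (2 - \<theta>)) powr (p / 2 - 1)"])
      fix \<theta> :: real assume \<theta>: "0 < \<theta>" "\<theta> < 1"
      have "1 - (1 - \<theta>)\<^sup>2 = \<theta> * (2 - \<theta>)" by (simp add: power2_eq_square algebra_simps)
      then show "(\<Sum>S | S \<subseteq> {1..n} \<and> k \<le> card S. (L2_inner n f (walsh S))\<^sup>2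
            * (real (card S choose k) * (1 - \<theta>) ^ (card S - k)))
          \<le> A * ((\<theta> * (2 - \<theta>)) powr (p / 2 - 1)) ^ k"
        using noise_energy_bound[OF assms(3) _ p, of "1 - \<theta>" k] \<theta> by (simp add: A_def mult_ac)
    next
      fix \<theta> :: real assume \<theta>: "0 < \<theta>" "\<theta> < 1"
      show "(Beta_half p has_real_derivative (\<theta> * (2 - \<theta>)) powr (p / 2 - 1)) (at \<theta>)"
        using p \<theta> by (intro Beta_half_deriv) auto
      show "\<theta> * (\<theta> * (2 - \<theta>)) powr (p / 2 - 1) \<le> Beta_half p \<theta>"
        using p \<theta> by (intro Beta_half_ge) auto
    qed (use False A p in \<open>auto simp: Beta_half_0 intro: Beta_half_continuous\<close>)
  qed
  then have "C_const p ^ k * high_weight n k f \<le> C_const p ^ k * (A * Beta_half p 1 ^ k)"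
    using B by (intro mult_left_mono) (auto simp: C_const_Beta_half)
  also have "\<dots> = A" using B by (simp add: C_const_Beta_half power_one_over)
  finally show ?thesis by (simp add: norm)
qed

end
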